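(* Let $f:\mathbb{Z}_{\ge 0}\to\mathbb{Z}_{\ge 0}$ be a function. (1) If $f$ satisfies the tasty condition, then for all $x,y\in\mathbb{Z}_{\ge 0}$, $$\mathcal{G}(\mathrm{CHCG}(f,x,y))=x\oplus\min(f(x),y).$$ (2) Suppose $f$ is monotone (i.e. weakly increasing on $\mathbb{Z}_{\ge0}$ or weakly decreasing on $\mathbb{Z}_{\ge0}$). Then $\mathcal{G}(\mathrm{CHCG}(f,x,y))=x\oplus\min(f(x),y)$ holds for all $x,y\in\mathbb{Z}_{\ge 0}$ if and only if $f$ satisfies the tasty condition.
   Context: $\oplus$ denotes Nim-sum (bitwise XOR of nonnegative integers). For a position $G$ of an impartial game (finite play), the Sprague–Grundy value is $\mathcal{G}(G)=\mathrm{mex}\{\mathcal{G}(G') : G' \text{ an option of } G\}$, where $\mathrm{mex}(S)=\min(\mathbb{Z}_{\ge 0}\setminus S)$. Changing Height Chocolate Game: for $f:\mathbb{Z}_{\ge0}\to\mathbb{Z}_{\ge0}$ and $x,y\in\mathbb{Z}_{\ge 0}$, $\mathrm{CHCG}(f,x,y)$ is the chocolate bar with columns $i=0,1,\dots,x$, the $i$-th column having height $\min(f(i),y)+1$; the bottom square of column $0$ is bitter. A move cuts the bar along a vertical or horizontal groove and removes the part not containing the bitter square, with the rule that at least one square of the rightmost column must be removed. Thus the options of $\mathrm{CHCG}(f,x,y)$ are exactly $\mathrm{CHCG}(f,x',y)$ with $0\le x'<x$ and $\mathrm{CHCG}(f,x,y')$ with $0\le y'<\min(f(x),y)$. (A player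 with no legal move loses.) Tasty condition: a function $f:\mathbb{Z}_{\ge 0}\to\mathbb{Z}_{\ge 0}$ satisfies the tasty condition if for all $z,z'\in\mathbb{Z}_{\ge 0}$ and every positive integer $i$, $\lfloor z/2^i\rfloor=\lfloor z'/2^i\rfloor$ implies $\lfloor f(z)/2^{i-1}\rfloor=\lfloor f(z')/2^{i-1}\rfloor$. *)

theory Defs
  imports Main
begin

definition mex :: "nat set \<Rightarrow> nat" where
  "mex S = (LEAST n. n \<notin> S)"

text \<open>
  A game is given by its option function. The recursion is meaningful when the
  option relation is well-founded (finite play); see \<open>grundy_unfold\<close>.
\<close>

definition grundy :: "('a \<Rightarrow> 'a set) \<Rightarrow> 'a \<Rightarrow> nat" where
  "grundy options = wfrec {(q, p). q \<in> options p} (\<lambda>g p. mex (g ` options p))"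

lemma grundy_unfold:
  assumes "wf {(q, p). q \<in> options p}"
  shows "grundy options p = mex (grundy options ` options p)"
proof -
  let ?R = "{(q, p). q \<in> options p}"
  have "grundy options p = mex (cut (grundy options) ?R p ` options p)"
    unfolding grundy_def by (subst wfrec[OF assms]) (rule refl)
  also have "cut (grundy options) ?R p ` options p = grundy options ` options p"
    by (rule image_cong) (auto simp: cut_apply)
  finally show ?thesis .
qed

text \<open>
  A chocolate bar is the nonempty list of its column heights, counted in squares, from
  the bitter column on the left to the rightmost column. A vertical cut leaves the
  first \<open>k\<close> columns (and so always removes the whole rightmost column); a
  horizontal cut leaves the bottom \<open>h\<close> rows, where \<open>h\<close> has to be smaller than
  the height of the rightmost column.
\<close>

type_synonym bar = "nat list"

definition cuts :: "bar \<Rightarrow> bar set" where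
  "cuts b = {take k b | k. 1 \<le> k \<and> k < length b}
          \<union> {map (\<lambda>c. min c h) b | h. b \<noteq> [] \<and> 1 \<le> h \<and> h < last b}"

definition CHCG :: "(nat \<Rightarrow> nat) \<Rightarrow> nat \<Rightarrow> nat \<Rightarrow> bar" where
  "CHCG f x y = map (\<lambda>i. min (f i) y + 1) [0..<x + 1]"

lemma wf_cuts: "wf {(c, b). c \<in> cuts b}"
proof (rule wf_subset)
  show "wf (inv_image (less_than <*lex*> less_than) (\<lambda>b :: bar. (length b, last b)))"
    by (intro wf_inv_image wf_lex_prod wf_less_than)
  show "{(c, b). c \<in> cuts b}
      \<subseteq> inv_image (less_than <*lex*> less_than) (\<lambda>b :: bar. (length b, last b))"
    by (auto simp: cuts_def last_map)
qed

lemma cuts_CHCG: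
  "cuts (CHCG f x y) = {CHCG f x' y | x'. x' < x} \<union> {CHCG f x y' | y'. y' < min (f x) y}"
proof -
  have len: "length (CHCG f x y) = Suc x" and last: "last (CHCG f x y) = min (f x) y + 1"
    and ne: "CHCG f x y \<noteq> []"
    by (simp_all add: CHCG_def)
  have tk: "take (Suc x') (CHCG f x y) = CHCG f x' y" if "x' < x" for x'
    using that by (simp add: CHCG_def take_map take_upt del: upt_Suc)
  have mn: "map (\<lambda>c. min c (Suc y')) (CHCG f x y) = CHCG f x y'" if "y' < min (f x) y" for y'
    using that by (auto simp: CHCG_def)
  show ?thesis (is "_ = ?V \<union> ?H")
  proof (intro equalityI subsetI)
    fix c
    assume "c \<in> cuts (CHCG f x y)"
    then consider
        k where "c = take k (CHCG f x y)" "1 \<le> k" "k < Suc x"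
      | h where "c = map (\<lambda>c. min c h) (CHCG f x y)" "1 \<le> h" "h < min (f x) y + 1"
      unfolding cuts_def len last by blast
    then show "c \<in> ?V \<union> ?H"
    proof cases
      case 1
      then show ?thesis
        using tk[of "k - 1"] by (intro UnI1 CollectI exI[of _ "k - 1"]) simp
    next
      case 2
      then obtain y' where "h = Suc y'" "y' < min (f x) y"
        by (cases h) auto
      with 2 mn[of y'] show ?thesis
        by auto
    qed
  next
    fix c
    assume "c \<in> ?V \<union> ?H"
    then consider x' where "c = CHCG f x' y" "x' < x"
      | y' where "c = CHCG f x y'" "y' < min (f x) y"
      by blast
    then show "c \<in> cuts (CHCG f x y)"
    proof cases
      case 1
      then show ?thesis
        unfolding cuts_def len
        by (intro UnI1 CollectI exI[of _ "Suc x'"]) (simp add: tk)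
    next
      case 2
      then show ?thesis
        unfolding cuts_def last
        by (intro UnI2 CollectI exI[of _ "Suc y'"]) (simp add: mn ne)
    qed
  qed
qed

definition tasty :: "(nat \<Rightarrow> nat) \<Rightarrow> bool" where
  "tasty f \<longleftrightarrow> (\<forall>z z' i. 0 < i \<longrightarrow> z div 2 ^ i = z' div 2 ^ i \<longrightarrow>
      f z div 2 ^ (i - 1) = f z' div 2 ^ (i - 1))"

end

theory Submission imports Defs begin

text \<open>
  Fix the cutting height \<open>y\<close>, write \<open>g x = min (f x) y\<close> and consider the labelling
  \<open>\<phi> x = xor x (g x)\<close>, the Grundy value claimed for \<open>CHCG f x y\<close>. Everything turns on
  whether \<open>\<phi>\<close> is injective. As soon as it is, it is a bijection of the natural numbers,
  because \<open>g\<close> is bounded by \<open>y\<close> and therefore \<open>\<phi>\<close> maps every large enough initial segment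
  \<open>{..<2 ^ n}\<close> into itself (\<open>bij_bounded_xor\<close>).

  \<^bold>\<open>Sufficiency.\<close> Truncation preserves the tasty condition, so \<open>g\<close> is tasty. If \<open>k\<close> is the
  highest bit in which \<open>x\<close> and \<open>x'\<close> differ, tastiness makes \<open>g x\<close> and \<open>g x'\<close> agree from
  bit \<open>k\<close> upwards, so \<open>\<phi> x\<close> and \<open>\<phi> x'\<close> differ in bit \<open>k\<close>. Thus \<open>\<phi>\<close> is bijective and no
  option has the value \<open>\<phi> x\<close>. A smaller value \<open>v\<close> is \<open>\<phi> x'\<close> for some \<open>x' \<noteq> x\<close>. If
  \<open>x' < x\<close>, a vertical cut reaches it. If \<open>x' > x\<close>, then \<open>\<phi> x' < \<phi> x\<close> forces bit \<open>k\<close> of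
  \<open>g x\<close> to be set, and lowering the height to \<open>xor x v < g x\<close> is a legal horizontal cut with
  value \<open>v\<close> (\<open>tasty_smaller_value_reachable\<close>).

  \<^bold>\<open>Necessity.\<close> If the formula holds, positions joined by a vertical cut have distinct values,
  so \<open>\<phi>\<close> is bijective for every \<open>y\<close>. Compare the labellings for the heights
  \<open>y = e * 2 ^ k\<close> with \<open>e\<close> odd and \<open>y' = (e - 1) * 2 ^ k\<close>. Where \<open>f x < y\<close> they agree from
  bit \<open>k\<close> upwards; where \<open>f x \<ge> y\<close> they are the translations \<open>\<lambda>x. xor x y\<close> and \<open>\<lambda>x. xor x y'\<close>.
  Bijectivity transfers this to the sublevel set \<open>S = {x. f x < y}\<close>: each labelling maps \<open>S\<close> onto the
  corresponding translate of \<open>S\<close>. Counting the values in an interval of length \<open>2 ^ k\<close>, and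
  using that \<open>e\<close> and \<open>e - 1\<close> differ in the last bit only, one finds that \<open>S\<close> meets both halves
  of each dyadic interval of length \<open>2 ^ (k + 1)\<close> equally often (\<open>sublevel_balanced\<close>). For
  monotone \<open>f\<close> the set \<open>S\<close> is an initial or a final segment, and such a set is balanced in
  that way only if it contains or avoids the whole interval. A violation of the tasty condition
  supplies a threshold \<open>y\<close> that separates two points of one such interval.
\<close>

section \<open>Dyadic intervals and exclusive or\<close>

lemma xor_div_power2:
  fixes a b :: nat
  shows "xor a b div 2 ^ k = xor (a div 2 ^ k) (b div 2 ^ k)"
  by (metis drop_bit_eq_div drop_bit_xor)

lemma xor_less_power2:
  fixes a b :: nat
  assumes "a < 2 ^ n" and "b < 2 ^ n"
  shows "xor a b < 2 ^ n"
  using assms by (metis take_bit_nat_eq_self_iff take_bit_xor)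

lemma xor_left_self:
  fixes a b :: nat
  shows "xor a (xor a b) = b"
  by (metis xor.assoc xor.left_neutral xor_self_eq)

lemma xor_right_inject:
  fixes a b c :: nat
  shows "xor a c = xor b c \<longleftrightarrow> a = b"
  by (metis xor.commute xor_left_self)

lemma xor_double_Suc:
  fixes a b :: nat
  shows "xor (2 * a) (2 * b) = 2 * xor a b"
    and "xor (Suc (2 * a)) (2 * b) = Suc (2 * xor a b)"
    and "xor (2 * a) (Suc (2 * b)) = Suc (2 * xor a b)"
    and "xor (Suc (2 * a)) (Suc (2 * b)) = 2 * xor a b"
  using xor_nat_unfold[of "2 * a" "2 * b"] xor_nat_unfold[of "Suc (2 * a)" "2 * b"]
    xor_nat_unfold[of "2 * a" "Suc (2 * b)"] xor_nat_unfold[of "Suc (2 * a)" "Suc (2 * b)"]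
  by simp_all

lemma div_power2_mono_exponent:
  fixes a b :: nat
  assumes "a div 2 ^ i = b div 2 ^ i" and "i \<le> j"
  shows "a div 2 ^ j = b div 2 ^ j"
proof -
  have "(2::nat) ^ j = 2 ^ i * 2 ^ (j - i)"
    using assms(2) by (metis le_add_diff_inverse power_add)
  then show ?thesis
    using assms(1) by (simp add: div_mult2_eq)
qed

lemma highest_differing_bit:
  fixes a b :: nat
  assumes "a \<noteq> b"
  obtains k where "a div 2 ^ Suc k = b div 2 ^ Suc k" and "a div 2 ^ k \<noteq> b div 2 ^ k"
proof -
  let ?P = "\<lambda>j. a div 2 ^ j = b div 2 ^ j"
  have "a < 2 ^ (a + b)" "b < 2 ^ (a + b)"
    using less_exp[of "a + b"] by linarith+
  then have ex: "?P (a + b)"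
    by simp
  have nz: "\<not> ?P 0"
    using assms by simp
  then have "?P (LEAST j. ?P j)"
    using ex by (intro LeastI)
  moreover have "(LEAST j. ?P j) \<noteq> 0"
    using calculation nz by metis
  then obtain k where k: "(LEAST j. ?P j) = Suc k"
    using not0_implies_Suc by blast
  moreover have "\<not> ?P k"
    using k by (intro not_less_Least) simp
  ultimately show ?thesis
    using that by simp
qed

lemma odd_times_power2:
  fixes y :: nat
  assumes "0 < y"
  obtains e k where "y = e * 2 ^ k" and "odd e"
proof -
  have "\<exists>e k. y = e * 2 ^ k \<and> odd e"
    using assms
  proof (induction y rule: less_induct)
    case (less y)
    show ?case
    proof (cases "odd y")
      case True
      then have "y = y * 2 ^ 0 \<and> odd y"
        by simp
      then show ?thesis
        by blast
    next
      case False
      then obtain m where m: "y = 2 * m"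
        by blast
      then have "m < y" "0 < m"
        using less.prems by simp_all
      then obtain e k where "m = e * 2 ^ k" "odd e"
        using less.IH by blast
      then have "y = e * 2 ^ Suc k \<and> odd e"
        using m by simp
      then show ?thesis
        by blast
    qed
  qed
  then show ?thesis
    using that by blast
qed

text \<open>
  An initial segment whose length is a large power of two is closed under the map, and an
  injective self-map of a finite set is onto.
\<close>

lemma bij_bounded_xor:
  fixes g :: "nat \<Rightarrow> nat"
  assumes bound: "\<And>x. g x \<le> y" and inj: "inj (\<lambda>x. xor x (g x))"
  shows "bij (\<lambda>x. xor x (g x))"
proof -
  let ?\<phi> = "\<lambda>x. xor x (g x)"
  have "\<exists>x. v = ?\<phi> x" for v
  proof -
    let ?I = "{..<2 ^ (v + y) :: nat}"
    have y: "y < 2 ^ (v + y)" and v: "v \<in> ?I"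
      using less_exp[of "v + y"] by (simp_all, linarith+)
    have "?\<phi> ` ?I \<subseteq> ?I"
      using xor_less_power2 le_less_trans[OF bound y] by auto
    then have "?\<phi> ` ?I = ?I"
      using inj by (intro endo_inj_surj) (auto intro: inj_on_subset)
    then show ?thesis
      using v by blast
  qed
  then show ?thesis
    using inj by (auto simp: bij_def surj_def)
qed

section \<open>The mex recursion for bars\<close>

lemma mex_eqI:
  assumes "n \<notin> S" and "\<And>v. v < n \<Longrightarrow> v \<in> S"
  shows "mex S = n"
  unfolding mex_def using assms by (intro Least_equality) (auto simp: not_less[symmetric])

lemma mex_not_mem:
  assumes "finite S"
  shows "mex S \<notin> S"
  unfolding mex_def using ex_new_if_finite[OF infinite_UNIV_nat assms] by (rule LeastI_ex)

lemma grundy_CHCG: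
  "grundy cuts (CHCG f x y) =
    mex ((\<lambda>x'. grundy cuts (CHCG f x' y)) ` {..<x} \<union>
         (\<lambda>y'. grundy cuts (CHCG f x y')) ` {..<min (f x) y})"
proof -
  have "cuts (CHCG f x y) = (\<lambda>x'. CHCG f x' y) ` {..<x} \<union> CHCG f x ` {..<min (f x) y}"
    by (simp only: cuts_CHCG) blast
  then show ?thesis
    by (subst grundy_unfold[OF wf_cuts]) (simp only: image_Un image_image)
qed

section \<open>Tasty functions have the Nim-sum as Grundy value\<close>

lemma tastyD:
  assumes "tasty f" and "z div 2 ^ Suc k = z' div 2 ^ Suc k"
  shows "f z div 2 ^ k = f z' div 2 ^ k"
  using assms(1)[unfolded tasty_def, rule_format, of "Suc k" z z'] assms(2) by simp

lemma tasty_min: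
  assumes "tasty f"
  shows "tasty (\<lambda>x. min (f x) y)"
proof -
  have min_div: "min a y div 2 ^ k = min (a div 2 ^ k) (y div 2 ^ k)" for a k
    by (cases "a \<le> y") (simp_all add: div_le_mono min_absorb1 min_absorb2)
  show ?thesis
    unfolding tasty_def min_div using assms unfolding tasty_def by metis
qed

lemma inj_xor_tasty:
  assumes "tasty g"
  shows "inj (\<lambda>x. xor x (g x))"
proof (rule injI, rule ccontr)
  fix x x'
  assume eq: "xor x (g x) = xor x' (g x')" and "x \<noteq> x'"
  then obtain k where k: "x div 2 ^ Suc k = x' div 2 ^ Suc k" "x div 2 ^ k \<noteq> x' div 2 ^ k"
    using highest_differing_bit by blast
  have "g x div 2 ^ k = g x' div 2 ^ k"
    using assms k(1) by (rule tastyD)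
  then show False
    using arg_cong[OF eq, of "\<lambda>n. n div 2 ^ k"] k(2) by (simp add: xor_div_power2 xor_right_inject)
qed

text \<open>
  The two alternatives are a vertical and a horizontal cut. The second occurs when the unique
  \<open>x'\<close> carrying the label \<open>v\<close> lies to the right of \<open>x\<close>: in the highest bit where \<open>x\<close> and
  \<open>x'\<close> differ, \<open>x\<close> has 0; the labels agree above that bit and the one of \<open>x\<close> is larger, so
  \<open>g x\<close> has 1 there, and \<open>xor x v\<close> arises from \<open>g x\<close> by clearing that bit and changing lower ones.
\<close>

lemma tasty_smaller_value_reachable:
  assumes g: "tasty g" and bound: "\<And>x. g x \<le> y" and v: "v < xor x (g x)"
  shows "(\<exists>x'<x. v = xor x' (g x')) \<or> xor x v < g x"
proof -
  obtain x' where x': "v = xor x' (g x')"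
    using bij_bounded_xor[OF bound inj_xor_tasty[OF g]] by (metis bij_pointE)
  with v consider "x' < x" | "x < x'"
    by (metis less_irrefl linorder_neqE_nat)
  then show ?thesis
  proof cases
    case 1
    then show ?thesis
      using x' by blast
  next
    case 2
    then obtain k where k: "x div 2 ^ Suc k = x' div 2 ^ Suc k" "x div 2 ^ k \<noteq> x' div 2 ^ k"
      using highest_differing_bit by (metis less_irrefl)
    define c G where "c = x div 2 ^ Suc k" and "G = g x div 2 ^ k"
    have G': "g x' div 2 ^ k = G"
      using tastyD[OF g k(1)] by (simp add: G_def)
    have "x div 2 ^ k \<le> x' div 2 ^ k"
      using 2 by (simp add: div_le_mono)
    moreover have "x div 2 ^ k div 2 = c" "x' div 2 ^ k div 2 = c"
      using k(1) by (simp_all add: c_def div_mult2_eq[symmetric] mult.commute)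
    ultimately have c: "x div 2 ^ k = 2 * c" "x' div 2 ^ k = Suc (2 * c)"
      using k(2) by linarith+
    \<comment> \<open>Both labels, cut down to the bits from \<open>k\<close> upwards, differ in the last bit only; their order
      therefore decides the parity of \<open>G\<close>.\<close>
    have vk: "v div 2 ^ k = xor (Suc (2 * c)) G"
      by (simp add: x' xor_div_power2 c G')
    have "v div 2 ^ k \<le> xor x (g x) div 2 ^ k"
      using v by (simp add: div_le_mono)
    then have le: "xor (Suc (2 * c)) G \<le> xor (2 * c) G"
      by (simp only: vk) (simp add: xor_div_power2 c G_def)
    obtain h where h: "G = Suc (2 * h)"
    proof (cases "even G")
      case True
      then obtain h where "G = 2 * h"
        by blast
      then show ?thesis
        using le by (simp add: xor_double_Suc)
    next
      case False
      then show ?thesis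
        using that by (elim oddE) simp
    qed
    have "xor x v div 2 ^ k = 2 * h"
      by (simp add: xor_div_power2 c vk h xor_double_Suc xor_left_self)
    also have "\<dots> < G"
      by (simp add: h)
    finally have "xor x v < g x"
      unfolding G_def by (metis div_le_mono leD leI)
    then show ?thesis
      by blast
  qed
qed

theorem grundy_CHCG_tasty:
  assumes "tasty f"
  shows "grundy cuts (CHCG f x y) = xor x (min (f x) y)"
proof (induction "x + y" arbitrary: x y rule: less_induct)
  case less
  let ?g = "\<lambda>x. min (f x) y"
  let ?V = "(\<lambda>x'. xor x' (?g x')) ` {..<x}" and ?H = "xor x ` {..<?g x}"
  have V: "(\<lambda>x'. grundy cuts (CHCG f x' y)) ` {..<x} = ?V"
    by (intro image_cong refl less) simp
  have H: "(\<lambda>y'. grundy cuts (CHCG f x y')) ` {..<?g x} = ?H"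
  proof (intro image_cong refl)
    fix y'
    assume "y' \<in> {..<?g x}"
    then have "x + y' < x + y" "min (f x) y' = y'"
      by simp_all
    then show "grundy cuts (CHCG f x y') = xor x y'"
      using less[of x y'] by simp
  qed
  have g: "tasty ?g"
    using assms by (rule tasty_min)
  have "mex (?V \<union> ?H) = xor x (?g x)"
  proof (rule mex_eqI)
    have "xor x (?g x) \<notin> ?V"
    proof
      assume "xor x (?g x) \<in> ?V"
      then obtain x' where "x' < x" "xor x (?g x) = xor x' (?g x')"
        by blast
      then show False
        using injD[OF inj_xor_tasty[OF g], of x x'] by simp
    qed
    moreover have "xor x (?g x) \<notin> ?H"
    proof
      assume "xor x (?g x) \<in> ?H"
      then obtain y' where "y' < ?g x" and eq: "xor x (?g x) = xor x y'"
        by blast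
      have "?g x = xor x (xor x y')"
        using eq by (metis xor_left_self)
      then show False
        using \<open>y' < ?g x\<close> by (simp only: xor_left_self)
    qed
    ultimately show "xor x (?g x) \<notin> ?V \<union> ?H"
      by blast
  next
    fix v
    assume "v < xor x (?g x)"
    then consider x' where "x' < x" "v = xor x' (?g x')" | "xor x v < ?g x"
      using tasty_smaller_value_reachable[OF g min.cobounded2] by blast
    then show "v \<in> ?V \<union> ?H"
    proof cases
      case 1
      then show ?thesis
        by blast
    next
      case 2
      then have "xor x (xor x v) \<in> ?H"
        by blast
      then show ?thesis
        by (simp add: xor_left_self)
    qed
  qed
  then show ?case
    by (subst grundy_CHCG) (simp only: V H)
qed

section \<open>Bijective labellings force monotone functions to be tasty\<close>

text \<open>A vertical cut joins any two bars that differ in width only, so their values are distinct.\<close>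

lemma inj_grundy_width:
  "inj (\<lambda>x. grundy cuts (CHCG f x y))"
proof (rule linorder_injI)
  fix x x' :: nat
  assume "x < x'"
  let ?S = "(\<lambda>x. grundy cuts (CHCG f x y)) ` {..<x'} \<union>
    (\<lambda>y'. grundy cuts (CHCG f x' y')) ` {..<min (f x') y}"
  have "grundy cuts (CHCG f x' y) \<notin> ?S"
    by (subst grundy_CHCG, rule mex_not_mem) simp
  moreover have "grundy cuts (CHCG f x y) \<in> ?S"
    using \<open>x < x'\<close> by blast
  ultimately show "grundy cuts (CHCG f x y) \<noteq> grundy cuts (CHCG f x' y)"
    by metis
qed

text \<open>
  Off \<open>S\<close> the labelling coincides with the translation by \<open>y\<close>, which is also a bijection;
  hence both have the same image of \<open>S\<close>. The set \<open>S\<close> may be larger than the sublevel set of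
  \<open>y\<close>, so that two heights can be compared on one and the same set.
\<close>

lemma bij_betw_sublevel:
  fixes f :: "nat \<Rightarrow> nat"
  assumes bij: "bij (\<lambda>x. xor x (min (f x) y))" and S: "\<And>x. x \<notin> S \<Longrightarrow> y \<le> f x"
  shows "bij_betw (\<lambda>x. xor x (min (f x) y)) S ((\<lambda>x. xor x y) ` S)"
proof -
  let ?\<phi> = "\<lambda>x. xor x (min (f x) y)" and ?t = "\<lambda>x. xor x y"
  have "bij ?t"
    by (rule o_bij[of ?t]) (simp_all add: fun_eq_iff xor.assoc)
  have "?\<phi> ` S = - ?\<phi> ` (- S)"
    using bij by (simp add: bij_image_Compl_eq)
  also have "?\<phi> ` (- S) = ?t ` (- S)"
    using S by (intro image_cong refl) (simp add: min_absorb2)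
  also have "- ?t ` (- S) = ?t ` S"
    using \<open>bij ?t\<close> by (simp add: bij_image_Compl_eq)
  finally show ?thesis
    using bij by (auto simp: bij_betw_def bij_def intro: inj_on_subset)
qed

lemma card_labels_in_block:
  fixes f :: "nat \<Rightarrow> nat"
  assumes bij: "bij (\<lambda>x. xor x (min (f x) y))" and S: "\<And>x. x \<notin> S \<Longrightarrow> y \<le> f x"
  shows "card {x \<in> S. xor x (min (f x) y) div 2 ^ k = b} =
    card {x \<in> S. x div 2 ^ k = xor b (y div 2 ^ k)}"
proof -
  let ?\<phi> = "\<lambda>x. xor x (min (f x) y)" and ?t = "\<lambda>x. xor x y"
  let ?T = "{v \<in> ?t ` S. v div 2 ^ k = b}"
  have \<phi>: "inj_on ?\<phi> S" "?\<phi> ` S = ?t ` S"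
    using bij_betw_sublevel[OF assms] by (auto simp: bij_betw_def)
  have "card {x \<in> S. ?\<phi> x div 2 ^ k = b} = card (?\<phi> ` {x \<in> S. ?\<phi> x div 2 ^ k = b})"
    using \<phi>(1) by (intro card_image[symmetric]) (auto intro: inj_on_subset)
  also have "?\<phi> ` {x \<in> S. ?\<phi> x div 2 ^ k = b} = {v \<in> ?\<phi> ` S. v div 2 ^ k = b}"
    by blast
  also have "\<dots> = ?T"
    by (simp only: \<phi>(2))
  also have "?T = ?t ` {x \<in> S. x div 2 ^ k = xor b (y div 2 ^ k)}"
    by (auto simp: xor_div_power2 xor.assoc)
  also have "card \<dots> = card {x \<in> S. x div 2 ^ k = xor b (y div 2 ^ k)}"
    by (intro card_image inj_onI) (simp add: xor_right_inject)
  finally show ?thesis .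
qed

text \<open>
  At a point of the sublevel set the labels for the heights \<open>e * 2 ^ k\<close> and \<open>(e - 1) * 2 ^ k\<close> lie
  in the same interval of length \<open>2 ^ k\<close>, so the two counts given by \<open>card_labels_in_block\<close> agree.
  The intervals counted are those with the indices \<open>xor b e\<close> and \<open>xor b (e - 1)\<close>, and for odd
  \<open>e\<close> these are the two halves of an interval of twice the length.
\<close>

lemma sublevel_balanced:
  fixes f :: "nat \<Rightarrow> nat"
  assumes bij: "\<And>y. bij (\<lambda>x. xor x (min (f x) y))" and "odd e"
  shows "card {x. f x < e * 2 ^ k \<and> x div 2 ^ k = 2 * c} =
    card {x. f x < e * 2 ^ k \<and> x div 2 ^ k = Suc (2 * c)}"
proof -
  obtain d where e: "e = Suc (2 * d)"
    using \<open>odd e\<close> by (elim oddE) simp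
  let ?S = "{x. f x < e * 2 ^ k}"
  let ?y' = "2 * d * 2 ^ k"
  have min_div: "min a (e * 2 ^ k) div 2 ^ k = min a ?y' div 2 ^ k" if "a < e * 2 ^ k" for a
  proof -
    have "a div 2 ^ k = 2 * d" if "?y' \<le> a"
      using that \<open>a < e * 2 ^ k\<close> by (intro div_nat_eqI) (simp_all add: e mult.commute)
    then show ?thesis
      using \<open>a < e * 2 ^ k\<close> by (auto simp: min_def)
  qed
  have same: "{x \<in> ?S. xor x (min (f x) (e * 2 ^ k)) div 2 ^ k = b} =
      {x \<in> ?S. xor x (min (f x) ?y') div 2 ^ k = b}" for b
    by (intro Collect_cong conj_cong refl) (simp only: mem_Collect_eq xor_div_power2 min_div)
  have e_S: "e * 2 ^ k \<le> f x" if "x \<notin> ?S" for x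
    using that by auto
  have d_S: "?y' \<le> f x" if "x \<notin> ?S" for x
    using e_S[OF that] by (simp add: e)
  let ?b = "xor (2 * c) (2 * d)"
  have "xor ?b e = Suc (2 * c)"
  proof -
    have "xor (xor c d) d = c"
      by (simp add: xor.assoc)
    then show ?thesis
      by (simp add: e xor_double_Suc)
  qed
  moreover have "xor ?b (2 * d) = 2 * c"
    by (simp add: xor.assoc)
  ultimately show ?thesis
    using card_labels_in_block[OF bij, of ?S, OF e_S, where k = k and b = ?b]
      card_labels_in_block[OF bij, of ?S, OF d_S, where k = k and b = ?b]
    unfolding same by simp
qed

text \<open>
  If \<open>S\<close> contains all of \<open>L\<close>, balance makes it contain all of \<open>U\<close>; if it misses a point of
  \<open>L\<close>, it misses all of \<open>U\<close>, and balance empties \<open>L\<close>. An initial segment is treated with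
  \<open>L\<close> to the left of \<open>U\<close>, a final segment with \<open>L\<close> to its right.
\<close>

lemma balanced_segment:
  fixes L U S :: "'a set"
  assumes fin: "finite L" "finite U" and "card L = card U"
    and bal: "card (L \<inter> S) = card (U \<inter> S)"
    and seg: "\<And>l u. l \<in> L \<Longrightarrow> u \<in> U \<Longrightarrow> u \<in> S \<Longrightarrow> l \<in> S"
  shows "L \<union> U \<subseteq> S \<or> (L \<union> U) \<inter> S = {}"
proof (cases "L \<subseteq> S")
  case True
  then have "card (U \<inter> S) = card U"
    using assms by (simp add: inf_absorb1)
  then have "U \<inter> S = U"
    using fin by (intro card_subset_eq) auto
  then show ?thesis
    using True by blast
next
  case False
  then have "U \<inter> S = {}"
    using seg by blast
  then have "L \<inter> S = {}"
    using bal fin by simp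
  then show ?thesis
    using \<open>U \<inter> S = {}\<close> by blast
qed

lemma sublevel_union_of_blocks:
  fixes f :: "nat \<Rightarrow> nat"
  assumes bij: "\<And>y. bij (\<lambda>x. xor x (min (f x) y))" and mono: "mono f \<or> antimono f"
    and "odd e" and zz': "z div 2 ^ Suc k = z' div 2 ^ Suc k"
  shows "f z < e * 2 ^ k \<longleftrightarrow> f z' < e * 2 ^ k"
proof -
  define c where "c = z div 2 ^ Suc k"
  define S where "S = {x. f x < e * 2 ^ k}"
  define B where "B b = {x :: nat. x div 2 ^ k = b}" for b
  have B: "B b = {b * 2 ^ k..<b * 2 ^ k + 2 ^ k}" for b
  proof -
    have iff: "x div 2 ^ k = b \<longleftrightarrow> b * 2 ^ k \<le> x \<and> x < b * 2 ^ k + 2 ^ k" for x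
    proof
      assume "x div 2 ^ k = b"
      then show "b * 2 ^ k \<le> x \<and> x < b * 2 ^ k + 2 ^ k"
        using div_times_less_eq_dividend[of x "2 ^ k"] dividend_less_div_times[of "2 ^ k" x]
        by (simp add: add.commute)
    next
      assume "b * 2 ^ k \<le> x \<and> x < b * 2 ^ k + 2 ^ k"
      then show "x div 2 ^ k = b"
        by (intro div_nat_eqI) (simp_all add: mult.commute add.commute)
    qed
    show ?thesis
      by (intro set_eqI) (simp only: B_def iff mem_Collect_eq atLeastLessThan_iff)
  qed
  have fin: "finite (B b)" and card: "card (B b) = 2 ^ k" for b
    by (simp_all add: B)
  have less: "l < u" if "l \<in> B (2 * c)" "u \<in> B (Suc (2 * c))" for l u
    using that by (auto simp: B)
  have bal: "card (B (2 * c) \<inter> S) = card (B (Suc (2 * c)) \<inter> S)"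
    using sublevel_balanced[OF bij \<open>odd e\<close>, of k c]
    by (simp add: B_def S_def Collect_conj_eq Int_commute)
  have "B (2 * c) \<union> B (Suc (2 * c)) \<subseteq> S \<or> (B (2 * c) \<union> B (Suc (2 * c))) \<inter> S = {}"
    using mono
  proof
    assume "mono f"
    then have "l \<in> S" if "l \<in> B (2 * c)" "u \<in> B (Suc (2 * c))" "u \<in> S" for l u
      using less[OF that(1,2)] that(3) monoD[of f l u] by (auto simp: S_def)
    then show ?thesis
      using balanced_segment[OF fin fin _ bal] by (simp add: card)
  next
    assume "antimono f"
    then have "u \<in> S" if "u \<in> B (Suc (2 * c))" "l \<in> B (2 * c)" "l \<in> S" for l u
      using less[OF that(2,1)] that(3) antimonoD[of f l u] by (auto simp: S_def)
    then show ?thesis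
      using balanced_segment[OF fin fin _ bal[symmetric]] by (simp add: card Un_commute)
  qed
  moreover have "x \<in> B (2 * c) \<union> B (Suc (2 * c))" if "x div 2 ^ Suc k = c" for x
  proof -
    have "x div 2 ^ k div 2 = c"
      using that by (simp add: div_mult2_eq[symmetric] mult.commute)
    then show ?thesis
      by (simp add: B_def) linarith
  qed
  then have "z \<in> B (2 * c) \<union> B (Suc (2 * c))" "z' \<in> B (2 * c) \<union> B (Suc (2 * c))"
    using zz' by (simp_all only: c_def)
  ultimately have "z \<in> S \<longleftrightarrow> z' \<in> S"
    by blast
  then show ?thesis
    by (simp add: S_def)
qed

text \<open>
  The threshold that separates two points violating the tasty condition at level \<open>i\<close> is the
  largest multiple of \<open>2 ^ (i - 1)\<close> not exceeding the larger value. It may be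
  divisible by a higher power of two; this only enlarges the interval, which then still contains both points.
\<close>

lemma tasty_if_bij:
  fixes f :: "nat \<Rightarrow> nat"
  assumes bij: "\<And>y. bij (\<lambda>x. xor x (min (f x) y))" and mono: "mono f \<or> antimono f"
  shows "tasty f"
proof -
  have le: "f z' div 2 ^ j \<le> f z div 2 ^ j" if zz': "z div 2 ^ Suc j = z' div 2 ^ Suc j" for z z' j
  proof (rule ccontr)
    define y where "y = f z' div 2 ^ j * 2 ^ j"
    assume "\<not> f z' div 2 ^ j \<le> f z div 2 ^ j"
    then have less: "f z < y" and ge: "y \<le> f z'"
      by (simp_all add: y_def div_less_iff_less_mult[symmetric])
    then obtain e k where y: "y = e * 2 ^ k" and "odd e"
      using odd_times_power2[of y] by auto
    have "j \<le> k"
    proof (rule ccontr)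
      assume "\<not> j \<le> k"
      then have "2 ^ Suc k dvd y"
        unfolding y_def by (intro dvd_mult le_imp_power_dvd) simp
      then show False
        using \<open>odd e\<close> by (simp add: y)
    qed
    then have "z div 2 ^ Suc k = z' div 2 ^ Suc k"
      using div_power2_mono_exponent[OF zz', of "Suc k"] by simp
    then have "f z < y \<longleftrightarrow> f z' < y"
      unfolding y using sublevel_union_of_blocks[OF bij mono \<open>odd e\<close>] by blast
    then show False
      using less ge by simp
  qed
  show ?thesis
    unfolding tasty_def
  proof (intro allI impI)
    fix z z' i :: nat
    assume "0 < i" and eq: "z div 2 ^ i = z' div 2 ^ i"
    then obtain j where "i = Suc j"
      using gr0_implies_Suc by blast
    then show "f z div 2 ^ (i - 1) = f z' div 2 ^ (i - 1)"
      using le[of z j z'] le[of z' j z] eq by simp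
  qed
qed

theorem theorem13:
  fixes f :: "nat \<Rightarrow> nat"
  shows "(tasty f \<longrightarrow> (\<forall>x y. grundy cuts (CHCG f x y) = xor x (min (f x) y))) \<and>
         (mono f \<or> antimono f \<longrightarrow>
           ((\<forall>x y. grundy cuts (CHCG f x y) = xor x (min (f x) y)) \<longleftrightarrow> tasty f))"
proof -
  have "tasty f" if mono: "mono f \<or> antimono f"
    and formula: "\<forall>x y. grundy cuts (CHCG f x y) = xor x (min (f x) y)"
  proof (rule tasty_if_bij[OF _ mono])
    fix y
    have "inj (\<lambda>x. xor x (min (f x) y))"
      using inj_grundy_width[of f y] formula by simp
    then show "bij (\<lambda>x. xor x (min (f x) y))"
      by (rule bij_bounded_xor[OF min.cobounded2])
  qed
  then show ?thesis
    using grundy_CHCG_tasty by blast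
qed

end
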